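(* Let $G$ be a labeled graph on $n$ vertices with label set $X$ and let $H$ be a labeled graph on $m$ vertices with label set $B$. If $G$ has a leaf and is hang-symmetric at a vertex labeled $i$, and $H$ is hang-symmetric at a vertex labeled $j$ (taken as the root of $H$), then the hang group $\mathbf{H}_{(j,i)}(G*H)$ of the comb product $G*H$ is either equal to $S_m\wr S_n=\operatorname{Sym}(B)\wr\operatorname{Sym}(X)$ or to $S_{mn}=\operatorname{Sym}(B\times X)$.
   Context: All graphs are finite and simple; a leaf is a vertex of degree $1$. A labeled graph $G$ comes with a bijection $\lambda:V(G)\to X$ onto a label set $X$; write $v_x=\lambda^{-1}(x)$ and $L_G=\{ij: v_iv_j\in E(G)\}$ (unordered pairs). For $\sigma\in\operatorname{Sym}(X)$, $G_\sigma$ is the graph on $V(G)$ with edge set $\{v_iv_j:\sigma(i)\sigma(j)\in L_G\}$. $\operatorname{Aut}(G)$ is identified with $\{\sigma\in\operatorname{Sym}(X): G_\sigma=G\}$. An edge-replacement $rs\to kl$ removes an edge $v_rv_s\in E(G)$ and adds $v_kv_l\in E(\overline G)\cup\{v_rv_s\}$; it is feasible if $G-v_rv_s+v_kv_l\cong G$. $R_G$ is the set of feasible edge-replacements $rs\to kl$ with $rs\ne kl$ together with the neutral replacement $\emptyset\to\emptyset$ (nothing changes). $\operatorname{Fer}_G(rs\to kl)=\{\sigma\in\operatorname{Sym}(X): G_\sigma=G-v_rv_s+v_kv_l\}$ and $\operatorname{Fer}_G(\emptyset\to\emptyset)=\operatorname{Aut}(G)$. $\mathcal{E}_G$ is the union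 of the sets $\operatorname{Fer}_G(e\to e')$ over all $e\to e'\in R_G$. For $i\in X$, $\mathcal{E}_G^i=\{\sigma\in\mathcal{E}_G:\sigma(i)=i\}$; the hang group of $G$ at $i$ is $\mathbf{H}_i(G)=\langle\mathcal{E}_G^i\cup\operatorname{Aut}(G)\rangle$, and $G$ is hang-symmetric at $v_i$ if $\mathbf{H}_i(G)=\operatorname{Sym}(X)$. Comb product: for a graph $G$ and a graph $H$ with root $v$, $G*H$ has vertex set $V(G)\times V(H)$, with an edge between $(u,v)$ and $(u',v)$ for each $uu'\in E(G)$, and an edge between $(u,w)$ and $(u,w')$ for each $u\in V(G)$ and $ww'\in E(H)$. If $G$, $H$ have label sets $X$, $B$, then $G*H$ has label set $B\times X$, where $(u,w)$ gets the label $(b,x)$ with $b$ the label of $w$ and $x$ the label of $u$. Wreath product: for $S\le\operatorname{Sym}(B)$, $T\le\operatorname{Sym}(X)$, $S\wr T\le\operatorname{Sym}(B\times X)$ is the subgroup generated by all maps $(b,x)\mapsto(b,\tau(x))$ with $\tau\in T$ and, for each $x_0\in X$ and $\sigma\in S$, the map sending $(b,x_0)\mapsto(\sigma(b),x_0)$ and fixing $(b,x)$ for $x\neq x_0$. *)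

theory Defs
  imports "HOL-Algebra.Sym_Groups"
begin

record ('v, 'x) lgraph =
  verts :: "'v set"
  edges :: "'v set set"
  labels :: "'x set"
  lab :: "'v \<Rightarrow> 'x"

definition all_pairs :: "'v set \<Rightarrow> 'v set set" where
  "all_pairs V = {{u, v} | u v. u \<in> V \<and> v \<in> V \<and> u \<noteq> v}"

definition labelled_graph :: "('v, 'x) lgraph \<Rightarrow> bool" where
  "labelled_graph G \<longleftrightarrow>
     finite (verts G) \<and> edges G \<subseteq> all_pairs (verts G) \<and> bij_betw (lab G) (verts G) (labels G)"

definition complement_edges :: "('v, 'x) lgraph \<Rightarrow> 'v set set" where
  "complement_edges G = all_pairs (verts G) - edges G"

definition degree :: "('v, 'x) lgraph \<Rightarrow> 'v \<Rightarrow> nat" where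
  "degree G v = card {e \<in> edges G. v \<in> e}"

definition leaf :: "('v, 'x) lgraph \<Rightarrow> 'v \<Rightarrow> bool" where
  "leaf G v \<longleftrightarrow> v \<in> verts G \<and> degree G v = 1"

text \<open>Isomorphism of the underlying graphs; the labels are ignored.\<close>

definition graph_iso :: "('v, 'x) lgraph \<Rightarrow> ('w, 'y) lgraph \<Rightarrow> bool" where
  "graph_iso G H \<longleftrightarrow>
     (\<exists>f. bij_betw f (verts G) (verts H) \<and>
          (\<forall>u\<in>verts G. \<forall>v\<in>verts G. {u, v} \<in> edges G \<longleftrightarrow> {f u, f v} \<in> edges H))"

definition vtx :: "('v, 'x) lgraph \<Rightarrow> 'x \<Rightarrow> 'v" where
  "vtx G i = the_inv_into (verts G) (lab G) i"

definition label_edges :: "('v, 'x) lgraph \<Rightarrow> 'x set set" where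
  "label_edges G =
     {{i, j} | i j. i \<in> labels G \<and> j \<in> labels G \<and> {vtx G i, vtx G j} \<in> edges G}"

text \<open>
  The graph written $G_\sigma$. Vertices and labelling are kept, so equality of such records
  amounts to equality of edge sets on the fixed vertex set.
\<close>

definition perm_graph :: "('v, 'x) lgraph \<Rightarrow> ('x \<Rightarrow> 'x) \<Rightarrow> ('v, 'x) lgraph" where
  "perm_graph G \<sigma> = G\<lparr>edges :=
     {{vtx G i, vtx G j} | i j. i \<in> labels G \<and> j \<in> labels G \<and> {\<sigma> i, \<sigma> j} \<in> label_edges G}\<rparr>"

text \<open>
  \<open>Replace e e'\<close> stands for $rs \to kl$ with \<open>e = {r, s}\<close> and \<open>e' = {k, l}\<close> unordered pairs of
  labels; \<open>Neutral\<close> stands for $\emptyset \to \emptyset$.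
\<close>

datatype 'x replacement = Neutral | Replace "'x set" "'x set"

definition replace_edge :: "('v, 'x) lgraph \<Rightarrow> 'x set \<Rightarrow> 'x set \<Rightarrow> ('v, 'x) lgraph" where
  "replace_edge G e e' = G\<lparr>edges := (edges G - {vtx G ` e}) \<union> {vtx G ` e'}\<rparr>"

definition edge_replacement :: "('v, 'x) lgraph \<Rightarrow> 'x set \<Rightarrow> 'x set \<Rightarrow> bool" where
  "edge_replacement G e e' \<longleftrightarrow>
     e \<subseteq> labels G \<and> e' \<subseteq> labels G \<and> vtx G ` e \<in> edges G \<and>
     vtx G ` e' \<in> complement_edges G \<union> {vtx G ` e}"

definition feasible :: "('v, 'x) lgraph \<Rightarrow> 'x set \<Rightarrow> 'x set \<Rightarrow> bool" where
  "feasible G e e' \<longleftrightarrow> edge_replacement G e e' \<and> graph_iso (replace_edge G e e') G"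

definition feasible_replacements :: "('v, 'x) lgraph \<Rightarrow> 'x replacement set" where
  "feasible_replacements G = {Replace e e' | e e'. feasible G e e' \<and> e \<noteq> e'} \<union> {Neutral}"

definition Aut :: "('v, 'x) lgraph \<Rightarrow> ('x \<Rightarrow> 'x) set" where
  "Aut G = {\<sigma>. \<sigma> permutes labels G \<and> perm_graph G \<sigma> = G}"

fun Fer :: "('v, 'x) lgraph \<Rightarrow> 'x replacement \<Rightarrow> ('x \<Rightarrow> 'x) set" where
  "Fer G Neutral = Aut G"
| "Fer G (Replace e e') = {\<sigma>. \<sigma> permutes labels G \<and> perm_graph G \<sigma> = replace_edge G e e'}"

definition Fer_all :: "('v, 'x) lgraph \<Rightarrow> ('x \<Rightarrow> 'x) set" where
  "Fer_all G = (\<Union>\<rho>\<in>feasible_replacements G. Fer G \<rho>)"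

definition Fer_fix :: "('v, 'x) lgraph \<Rightarrow> 'x \<Rightarrow> ('x \<Rightarrow> 'x) set" where
  "Fer_fix G i = {\<sigma> \<in> Fer_all G. \<sigma> i = i}"

text \<open>
  The library's \<^const>\<open>sym_group\<close> for an arbitrary set: a permutation of \<open>X\<close> is a function that
  is the identity outside \<open>X\<close>.
\<close>

definition Sym :: "'a set \<Rightarrow> ('a \<Rightarrow> 'a) monoid" where
  "Sym X = \<lparr>carrier = {\<sigma>. \<sigma> permutes X}, mult = (\<circ>), one = id\<rparr>"

lemma Sym_atLeastAtMost: "Sym {1..n} = sym_group n"
  by (simp add: Sym_def sym_group_def)

lemma group_Sym: "group (Sym X)"
proof (rule groupI)
  fix \<sigma> assume "\<sigma> \<in> carrier (Sym X)"
  then show "\<exists>\<tau>\<in>carrier (Sym X). \<tau> \<otimes>\<^bsub>Sym X\<^esub> \<sigma> = \<one>\<^bsub>Sym X\<^esub>"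
    by (auto simp: Sym_def intro!: bexI[of _ "inv_into UNIV \<sigma>"]
        dest: permutes_inv_o permutes_inv)
qed (auto simp: Sym_def permutes_compose permutes_id comp_assoc)

definition hang_group :: "('v, 'x) lgraph \<Rightarrow> 'x \<Rightarrow> ('x \<Rightarrow> 'x) set" where
  "hang_group G i = generate (Sym (labels G)) (Fer_fix G i \<union> Aut G)"

definition hang_symmetric_at :: "('v, 'x) lgraph \<Rightarrow> 'v \<Rightarrow> bool" where
  "hang_symmetric_at G v \<longleftrightarrow> hang_group G (lab G v) = carrier (Sym (labels G))"

text \<open>
  In \<open>wreath_base\<close> the guard \<open>b \<in> B\<close> makes the map the identity outside \<open>B \<times> X\<close>; in
  \<open>wreath_fibre\<close> this is automatic because \<open>\<sigma>\<close> permutes \<open>B\<close>.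
\<close>

definition wreath_base :: "'b set \<Rightarrow> ('x \<Rightarrow> 'x) \<Rightarrow> 'b \<times> 'x \<Rightarrow> 'b \<times> 'x" where
  "wreath_base B \<tau> = (\<lambda>(b, x). if b \<in> B then (b, \<tau> x) else (b, x))"

definition wreath_fibre :: "'x \<Rightarrow> ('b \<Rightarrow> 'b) \<Rightarrow> 'b \<times> 'x \<Rightarrow> 'b \<times> 'x" where
  "wreath_fibre x\<^sub>0 \<sigma> = (\<lambda>(b, x). if x = x\<^sub>0 then (\<sigma> b, x) else (b, x))"

definition wreath ::
  "'b set \<Rightarrow> 'x set \<Rightarrow> ('b \<Rightarrow> 'b) set \<Rightarrow> ('x \<Rightarrow> 'x) set \<Rightarrow> ('b \<times> 'x \<Rightarrow> 'b \<times> 'x) set" where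
  "wreath B X S T = generate (Sym (B \<times> X))
     ({wreath_base B \<tau> | \<tau>. \<tau> \<in> T} \<union> {wreath_fibre x\<^sub>0 \<sigma> | x\<^sub>0 \<sigma>. x\<^sub>0 \<in> X \<and> \<sigma> \<in> S})"

text \<open>A vertex is a pair (vertex of \<open>G\<close>, vertex of \<open>H\<close>), whereas a label is a pair
  (label of \<open>H\<close>, label of \<open>G\<close>).\<close>

definition comb_product ::
  "('u, 'x) lgraph \<Rightarrow> ('w, 'b) lgraph \<Rightarrow> 'w \<Rightarrow> ('u \<times> 'w, 'b \<times> 'x) lgraph" where
  "comb_product G H r = \<lparr>
     verts = verts G \<times> verts H,
     edges = {{(u, r), (u', r)} | u u'. {u, u'} \<in> edges G} \<union>
             {{(u, w), (u, w')} | u w w'. u \<in> verts G \<and> {w, w'} \<in> edges H},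
     labels = labels H \<times> labels G,
     lab = (\<lambda>(u, w). (lab H w, lab G u))\<rparr>"

end

theory Submission imports Defs begin

text \<open>A permutation of the labels lies in \<open>Fer_all\<close> iff it maps all label edges except at most one
  to label edges. With this criterion, the generators of the hang group of \<open>G\<close> at \<open>i\<close> lift
  directly to permutations of the copies of \<open>H\<close>, and those of \<open>H\<close> fixing \<open>j\<close> lift to any
  single copy. An automorphism of \<open>H\<close> that moves \<open>j\<close> lifts to the copy at a leaf, where it moves
  only the edge at that leaf; hang-symmetry provides a leaf different from \<open>i\<close>, so that the label
  \<open>(j, i)\<close> stays fixed. Hence the hang group contains the wreath product. A subgroup of the
  symmetric group containing the wreath product either preserves the blocks or contains all
  transpositions.\<close>

section \<open>Subgroups of the symmetric group\<close>

lemma carrier_Sym [simp]: "\<sigma> \<in> carrier (Sym X) \<longleftrightarrow> \<sigma> permutes X"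
  by (simp add: Sym_def)

lemma mult_Sym [simp]: "\<sigma> \<otimes>\<^bsub>Sym X\<^esub> \<tau> = \<sigma> \<circ> \<tau>"
  by (simp add: Sym_def)

lemma one_Sym [simp]: "\<one>\<^bsub>Sym X\<^esub> = id"
  by (simp add: Sym_def)

lemma m_inv_Sym:
  assumes "\<sigma> permutes X"
  shows "m_inv (Sym X) \<sigma> = inv_into UNIV \<sigma>"
  by (rule group.inv_equality[OF group_Sym])
    (use assms in \<open>auto simp: permutes_inv permutes_inv_o\<close>)

lemma subgroup_Sym_permutes: "subgroup K (Sym X) \<Longrightarrow> \<sigma> \<in> K \<Longrightarrow> \<sigma> permutes X"
  using subgroup.mem_carrier by fastforce

lemma subgroup_Sym_comp: "subgroup K (Sym X) \<Longrightarrow> \<sigma> \<in> K \<Longrightarrow> \<tau> \<in> K \<Longrightarrow> \<sigma> \<circ> \<tau> \<in> K"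
  using subgroup.m_closed by fastforce

lemma subgroup_Sym_inv: "subgroup K (Sym X) \<Longrightarrow> \<sigma> \<in> K \<Longrightarrow> inv_into UNIV \<sigma> \<in> K"
  by (metis m_inv_Sym subgroup.m_inv_closed subgroup_Sym_permutes)

text \<open>Conjugating by \<open>\<sigma>\<close> renames the entries of a transposition. So the
  relation "joined by a transposition in \<open>K\<close>" is invariant under
  \<open>K\<close>.\<close>

lemma subgroup_Sym_conj_transpose:
  assumes K: "subgroup K (Sym X)" and "\<sigma> \<in> K" "transpose p q \<in> K"
  shows "transpose (\<sigma> p) (\<sigma> q) \<in> K"
proof -
  have "bij \<sigma>"
    using subgroup_Sym_permutes[OF K \<open>\<sigma> \<in> K\<close>] permutes_bij by blast
  then have "transpose (\<sigma> p) (\<sigma> q) \<circ> \<sigma> = \<sigma> \<circ> transpose p q"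
    by (simp add: transpose_comp_eq bij_is_inj)
  then have "transpose (\<sigma> p) (\<sigma> q) = \<sigma> \<circ> transpose p q \<circ> inv_into UNIV \<sigma>"
    by (metis K assms(2) comp_assoc comp_id permutes_inv_o(1) subgroup_Sym_permutes)
  then show ?thesis
    using assms by (simp add: subgroup_Sym_comp subgroup_Sym_inv)
qed

text \<open>Transitivity of that relation: conjugating (p q) by (q s) gives (p s). This fails to be
  literal only if \<open>p\<close> equals \<open>q\<close> or \<open>s\<close>, where the result is
  an assumption or the identity.\<close>

lemma subgroup_Sym_transpose_trans:
  assumes K: "subgroup K (Sym X)" and "transpose p q \<in> K" "transpose q s \<in> K"
  shows "transpose p s \<in> K"
proof (cases "p = s \<or> p = q")
  case True
  then show ?thesis
    using assms subgroup.one_closed[OF K] by auto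
next
  case False
  then have "transpose (transpose q s p) (transpose q s q) \<in> K"
    using subgroup_Sym_conj_transpose[OF K assms(3,2)] by blast
  then show ?thesis
    using False by simp
qed

lemma subgroup_Sym_eq_carrier:
  assumes K: "subgroup K (Sym X)" and "finite X"
    and "\<And>p q. p \<in> X \<Longrightarrow> q \<in> X \<Longrightarrow> transpose p q \<in> K"
  shows "K = carrier (Sym X)"
proof
  show "carrier (Sym X) \<subseteq> K"
  proof
    fix \<sigma> assume "\<sigma> \<in> carrier (Sym X)"
    then have "\<sigma> permutes X" by simp
    then show "\<sigma> \<in> K"
      using \<open>finite X\<close>
    proof (induction rule: permutes_induct)
      case id
      then show ?case using subgroup.one_closed[OF K] by (simp add: id_def)
    next
      case (swap a b p)
      then show ?case using assms(3) subgroup_Sym_comp[OF K] by blast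
    qed
  qed
qed (use subgroup.subset[OF K] in blast)

lemma bij_permutes: "bij f \<Longrightarrow> (\<And>x. x \<notin> X \<Longrightarrow> f x = x) \<Longrightarrow> f permutes X"
  by (simp add: permutes_def bij_iff)

text \<open>Meant for maps induced on one coordinate of a permutation of
  \<open>B \<times> X\<close>: their surjectivity can be read off from the permutation, and
  finiteness supplies injectivity.\<close>

lemma finite_surj_permutes:
  assumes "finite X" "\<And>x. x \<in> X \<Longrightarrow> \<exists>y\<in>X. f y = x" "f ` X \<subseteq> X" "\<And>x. x \<notin> X \<Longrightarrow> f x = x"
  shows "f permutes X"
proof (rule bij_imp_permutes)
  have "f ` X = X"
    using assms by blast
  then show "bij_betw f X X"
    using \<open>finite X\<close> by (simp add: bij_betw_def eq_card_imp_inj_on)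
qed (use assms in auto)

section \<open>The wreath product\<close>

lemma wreath_base_apply: "wreath_base B \<tau> (b, x) = (if b \<in> B then (b, \<tau> x) else (b, x))"
  by (simp add: wreath_base_def)

lemma wreath_fibre_apply: "wreath_fibre y \<sigma> (b, x) = (if x = y then (\<sigma> b, x) else (b, x))"
  by (simp add: wreath_fibre_def)

lemma wreath_base_comp: "wreath_base B (\<sigma> \<circ> \<tau>) = wreath_base B \<sigma> \<circ> wreath_base B \<tau>"
  by (auto simp: wreath_base_apply)

lemma wreath_fibre_comp: "wreath_fibre y (\<sigma> \<circ> \<tau>) = wreath_fibre y \<sigma> \<circ> wreath_fibre y \<tau>"
  by (auto simp: wreath_fibre_apply)

lemma wreath_base_permutes:
  assumes "\<tau> permutes X"
  shows "wreath_base B \<tau> permutes B \<times> X"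
proof -
  have "wreath_base B (inv_into UNIV \<tau>) \<circ> wreath_base B \<tau> = id"
       "wreath_base B \<tau> \<circ> wreath_base B (inv_into UNIV \<tau>) = id"
    using permutes_inverses[OF assms] by (auto simp: wreath_base_apply)
  then have "bij (wreath_base B \<tau>)"
    by (rule o_bij)
  moreover have "wreath_base B \<tau> p = p" if "p \<notin> B \<times> X" for p
    using that assms by (cases p) (auto simp: wreath_base_apply permutes_not_in)
  ultimately show ?thesis
    by (rule bij_permutes)
qed

lemma wreath_fibre_permutes:
  assumes "\<sigma> permutes B" "y \<in> X"
  shows "wreath_fibre y \<sigma> permutes B \<times> X"
proof -
  have "wreath_fibre y (inv_into UNIV \<sigma>) \<circ> wreath_fibre y \<sigma> = id"
       "wreath_fibre y \<sigma> \<circ> wreath_fibre y (inv_into UNIV \<sigma>) = id"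
    using permutes_inverses[OF assms(1)] by (auto simp: wreath_fibre_apply)
  then have "bij (wreath_fibre y \<sigma>)"
    by (rule o_bij)
  moreover have "wreath_fibre y \<sigma> p = p" if "p \<notin> B \<times> X" for p
    using that assms by (cases p) (auto simp: wreath_fibre_apply permutes_not_in)
  ultimately show ?thesis
    by (rule bij_permutes)
qed

text \<open>Being a homomorphism, the lift sends a generated subgroup to the subgroup generated by
  the lifted generators; hang groups are transported this way.\<close>

lemma group_hom_wreath_base: "group_hom (Sym X) (Sym (B \<times> X)) (wreath_base B)"
  by (intro group_hom.intro group_hom_axioms.intro group_Sym)
    (auto simp: hom_def wreath_base_permutes wreath_base_comp)

lemma group_hom_wreath_fibre:
  "y \<in> X \<Longrightarrow> group_hom (Sym B) (Sym (B \<times> X)) (wreath_fibre y)"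
  by (intro group_hom.intro group_hom_axioms.intro group_Sym)
    (auto simp: hom_def wreath_fibre_permutes wreath_fibre_comp)

abbreviation full_wreath :: "'b set \<Rightarrow> 'x set \<Rightarrow> ('b \<times> 'x \<Rightarrow> 'b \<times> 'x) set" where
  "full_wreath B X \<equiv> wreath B X (carrier (Sym B)) (carrier (Sym X))"

lemma full_wreath_subset:
  assumes "subgroup K (Sym (B \<times> X))"
    and "\<And>\<tau>. \<tau> permutes X \<Longrightarrow> wreath_base B \<tau> \<in> K"
    and "\<And>y \<sigma>. y \<in> X \<Longrightarrow> \<sigma> permutes B \<Longrightarrow> wreath_fibre y \<sigma> \<in> K"
  shows "full_wreath B X \<subseteq> K"
  unfolding wreath_def
  by (rule group.generate_subgroup_incl[OF group_Sym]) (use assms in auto)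

lemma subgroup_full_wreath: "subgroup (full_wreath B X) (Sym (B \<times> X))"
  unfolding wreath_def
  by (rule group.generate_is_subgroup[OF group_Sym])
    (auto simp: wreath_base_permutes wreath_fibre_permutes)

lemma wreath_base_in_full_wreath: "\<tau> permutes X \<Longrightarrow> wreath_base B \<tau> \<in> full_wreath B X"
  unfolding wreath_def by (rule generate.incl) auto

lemma wreath_fibre_in_full_wreath:
  "y \<in> X \<Longrightarrow> \<sigma> permutes B \<Longrightarrow> wreath_fibre y \<sigma> \<in> full_wreath B X"
  unfolding wreath_def by (rule generate.incl) auto

text \<open>A permutation that keeps every block is a product of one fibre factor per block. The set
  \<open>Y\<close> holds the blocks still to be treated, and the induction splits off one factor at
  a time.\<close>

lemma fibrewise_in_full_wreath:
  assumes "finite B" "finite Y" "Y \<subseteq> X" "h permutes B \<times> Y" "\<And>p. snd (h p) = snd p"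
  shows "h \<in> full_wreath B X"
  using assms(2-)
proof (induction Y arbitrary: h rule: finite_induct)
  case empty
  then show ?case
    using subgroup.one_closed[OF subgroup_full_wreath, of B X] by (simp add: id_def)
next
  case (insert y Y)
  define \<sigma> where "\<sigma> b = fst (h (b, y))" for b
  have h_y: "h (b, y) = (\<sigma> b, y)" for b
    using insert.prems(3)[of "(b, y)"] by (simp add: \<sigma>_def prod_eq_iff)
  have \<sigma>: "\<sigma> permutes B"
  proof (rule finite_surj_permutes[OF \<open>finite B\<close>])
    show "\<exists>b'\<in>B. \<sigma> b' = b" if "b \<in> B" for b
    proof -
      have "(b, y) \<in> h ` (B \<times> insert y Y)"
        using permutes_image[OF insert.prems(2)] that by simp
      then obtain p where p: "p \<in> B \<times> insert y Y" "h p = (b, y)"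
        by (elim imageE) simp
      then have "p = (fst p, y)"
        using insert.prems(3)[of p] p(2) by (simp add: prod_eq_iff)
      with p h_y show ?thesis
        by (metis fst_conv mem_Sigma_iff)
    qed
    show "\<sigma> ` B \<subseteq> B"
    proof clarify
      fix b assume "b \<in> B"
      then have "h (b, y) \<in> B \<times> insert y Y"
        by (simp add: permutes_in_image[OF insert.prems(2)])
      then show "\<sigma> b \<in> B"
        by (simp add: h_y)
    qed
    show "\<sigma> b = b" if "b \<notin> B" for b
      using permutes_not_in[OF insert.prems(2), of "(b, y)"] that h_y by auto
  qed
  let ?f = "wreath_fibre y (inv_into UNIV \<sigma>)"
  have f: "?f permutes B \<times> insert y Y"
    by (simp add: \<sigma> permutes_inv wreath_fibre_permutes)
  have snd_f: "snd (?f p) = snd p" for p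
    by (cases p) (simp add: wreath_fibre_apply)
  \<comment> \<open>On the block of \<open>y\<close>, \<open>h\<close> acts as
    \<open>\<sigma>\<close>, so composing with the inverse fibre factor makes that block pointwise
    fixed and the support shrinks to \<open>Y\<close>.\<close>
  have "?f \<circ> h permutes B \<times> Y"
  proof (rule permutes_superset)
    show "?f \<circ> h permutes B \<times> insert y Y"
      using f insert.prems(2) permutes_compose by blast
    have "(?f \<circ> h) (b, y) = (b, y)" for b
      using permutes_inverses(2)[OF \<sigma>] by (simp add: h_y wreath_fibre_apply)
    then show "(?f \<circ> h) p = p" if "p \<in> B \<times> insert y Y - B \<times> Y" for p
      using that by auto
  qed
  then have fh: "?f \<circ> h \<in> full_wreath B X"
    by (rule insert.IH[rotated]) (use insert.prems snd_f in auto)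
  have f': "wreath_fibre y \<sigma> \<in> full_wreath B X"
    using \<sigma> insert.prems(1) wreath_fibre_in_full_wreath by auto
  have "wreath_fibre y \<sigma> \<circ> ?f = id"
    using permutes_inverses[OF \<sigma>] by (auto simp: wreath_fibre_apply)
  then have h: "wreath_fibre y \<sigma> \<circ> (?f \<circ> h) = h"
    by (simp add: o_assoc)
  show ?case
    using subgroup_Sym_comp[OF subgroup_full_wreath f' fh] unfolding h .
qed

text \<open>The induced permutation \<open>\<tau>\<close> of the blocks can be read off at the
  single element \<open>j\<close>. Dividing by its base lift leaves a permutation that keeps every
  block.\<close>

lemma block_preserving_in_full_wreath:
  assumes "finite B" "finite X" "j \<in> B" "g permutes B \<times> X"
    and blocks: "\<And>a b x. a \<in> B \<Longrightarrow> b \<in> B \<Longrightarrow> x \<in> X \<Longrightarrow> snd (g (a, x)) = snd (g (b, x))"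
  shows "g \<in> full_wreath B X"
proof -
  define \<tau> where "\<tau> x = snd (g (j, x))" for x
  have snd_g: "snd (g (b, x)) = \<tau> x" if "b \<in> B" for b x
  proof (cases "x \<in> X")
    case True
    then show ?thesis using blocks[OF that \<open>j \<in> B\<close>] by (simp add: \<tau>_def)
  next
    case False
    then show ?thesis using permutes_not_in[OF assms(4)] by (simp add: \<tau>_def)
  qed
  have \<tau>: "\<tau> permutes X"
  proof (rule finite_surj_permutes[OF \<open>finite X\<close>])
    show "\<exists>y\<in>X. \<tau> y = x" if "x \<in> X" for x
    proof -
      have "(j, x) \<in> g ` (B \<times> X)"
        using permutes_image[OF assms(4)] that \<open>j \<in> B\<close> by simp
      then obtain b y where "b \<in> B" "y \<in> X" "g (b, y) = (j, x)"
        by auto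
      then show ?thesis
        using snd_g by (metis snd_conv)
    qed
    show "\<tau> ` X \<subseteq> X"
    proof clarify
      fix x assume "x \<in> X"
      then have "g (j, x) \<in> B \<times> X"
        using permutes_in_image[OF assms(4)] \<open>j \<in> B\<close> by simp
      then show "\<tau> x \<in> X"
        by (auto simp: \<tau>_def)
    qed
    show "\<tau> x = x" if "x \<notin> X" for x
      using permutes_not_in[OF assms(4)] that by (simp add: \<tau>_def)
  qed
  let ?t = "wreath_base B (inv_into UNIV \<tau>)"
  have tg: "?t \<circ> g \<in> full_wreath B X"
  proof (rule fibrewise_in_full_wreath[OF assms(1,2) subset_refl])
    show "?t \<circ> g permutes B \<times> X"
      using assms(4) \<tau> by (intro permutes_compose wreath_base_permutes permutes_inv)
    \<comment> \<open>The base lift acts only where the first coordinate lies in \<open>B\<close>.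
      Hence \<open>g\<close> must be seen to keep it there; for \<open>b\<close> outside
      \<open>B\<close> both maps fix the point.\<close>
    have "snd (?t (g (b, x))) = x" for b x
    proof (cases "b \<in> B")
      case b: True
      then have "fst (g (b, x)) \<in> B"
        using permutes_in_image[OF assms(4), of "(b, x)"] permutes_not_in[OF assms(4), of "(b, x)"]
        by (metis fst_conv mem_Times_iff)
      then show ?thesis
        using snd_g[OF b, of x] permutes_inverses(2)[OF \<tau>]
        by (cases "g (b, x)") (simp add: wreath_base_apply)
    next
      case False
      then show ?thesis
        using permutes_not_in[OF assms(4), of "(b, x)"] by (simp add: wreath_base_apply)
    qed
    then show "snd ((?t \<circ> g) p) = snd p" for p
      by (cases p) simp
  qed
  have "wreath_base B \<tau> \<circ> ?t = id"
    using permutes_inverses[OF \<tau>] by (auto simp: wreath_base_apply)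
  then have g: "wreath_base B \<tau> \<circ> (?t \<circ> g) = g"
    by (simp add: o_assoc)
  show ?thesis
    using subgroup_Sym_comp[OF subgroup_full_wreath wreath_base_in_full_wreath[OF \<tau>] tg]
    unfolding g .
qed

text \<open>Lying in a common \<open>K\<close>-transposition is a \<open>K\<close>-invariant equivalence relation. Its
  classes are unions of blocks, and the base group is 2-transitive on blocks, so the classes are
  either the blocks themselves or everything.\<close>

lemma full_wreath_maximal:
  assumes "finite B" "finite X" "B \<noteq> {}"
    and K: "subgroup K (Sym (B \<times> X))" and W: "full_wreath B X \<subseteq> K"
  shows "K = full_wreath B X \<or> K = carrier (Sym (B \<times> X))"
proof -
  have block: "transpose (a, x) (b, x) \<in> K" if "a \<in> B" "b \<in> B" "x \<in> X" for a b x
  proof -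
    have "wreath_fibre x (transpose a b) = transpose (a, x) (b, x)"
      by (auto simp: wreath_fibre_apply transpose_def)
    then show ?thesis
      using W wreath_fibre_in_full_wreath[OF \<open>x \<in> X\<close> permutes_swap_id[OF that(1,2)]] by auto
  qed
  show ?thesis
  proof (cases "\<exists>a\<in>B. \<exists>b\<in>B. \<exists>x\<in>X. \<exists>y\<in>X. x \<noteq> y \<and> transpose (a, x) (b, y) \<in> K")
    case True
    then obtain a b x y where ab: "a \<in> B" "b \<in> B" "x \<in> X" "y \<in> X" "x \<noteq> y"
      and t: "transpose (a, x) (b, y) \<in> K" by blast
    have tx: "transpose (a, x) (c, z) \<in> K" if "c \<in> B" "z \<in> X" for c z
    proof (cases "z = x")
      case True
      then show ?thesis using block ab that by simp
    next
      case False
      \<comment> \<open>Since \<open>x\<close> differs from \<open>y\<close> and \<open>z\<close>,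
        conjugation by this element fixes \<open>(a, x)\<close> and carries \<open>(b, y)\<close> to
        \<open>(b, z)\<close>. So one transposition across blocks reaches every other block.\<close>
      have "wreath_base B (transpose y z) \<in> K"
        using W wreath_base_in_full_wreath[OF permutes_swap_id[OF \<open>y \<in> X\<close> \<open>z \<in> X\<close>]] by auto
      then have "transpose (a, x) (b, z) \<in> K"
        using subgroup_Sym_conj_transpose[OF K _ t, of "wreath_base B (transpose y z)"] False ab
        by (simp add: wreath_base_apply)
      then show ?thesis
        using block[OF \<open>b \<in> B\<close> that] subgroup_Sym_transpose_trans[OF K] by blast
    qed
    have "K = carrier (Sym (B \<times> X))"
    proof (rule subgroup_Sym_eq_carrier[OF K])
      show "transpose p q \<in> K" if "p \<in> B \<times> X" "q \<in> B \<times> X" for p q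
        using that tx subgroup_Sym_transpose_trans[OF K, of p "(a, x)" q]
        by (auto simp: transpose_commute[of _ "(a, x)"])
    qed (use assms in simp)
    then show ?thesis ..
  next
    case False
    obtain j where "j \<in> B" using \<open>B \<noteq> {}\<close> by blast
    have "g \<in> full_wreath B X" if "g \<in> K" for g
    proof (rule block_preserving_in_full_wreath[OF assms(1,2) \<open>j \<in> B\<close>])
      show g: "g permutes B \<times> X"
        using subgroup_Sym_permutes[OF K that] .
      show "snd (g (a, x)) = snd (g (b, x))" if "a \<in> B" "b \<in> B" "x \<in> X" for a b x
      proof -
        \<comment> \<open>Two points of one block are joined by a transposition in \<open>K\<close>,
          hence so are their images. In the present case this forces the images into one
          block.\<close>
        have "transpose (g (a, x)) (g (b, x)) \<in> K"
          using subgroup_Sym_conj_transpose[OF K \<open>g \<in> K\<close>] block that by blast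
        moreover have "g (a, x) \<in> B \<times> X" "g (b, x) \<in> B \<times> X"
          using that permutes_in_image[OF g] by auto
        ultimately show ?thesis
          using False by (metis mem_Times_iff prod.collapse)
      qed
    qed
    then show ?thesis
      using W by blast
  qed
qed

section \<open>Permutations close to automorphisms\<close>

lemma vtx_lab: "labelled_graph G \<Longrightarrow> v \<in> verts G \<Longrightarrow> vtx G (lab G v) = v"
  unfolding vtx_def labelled_graph_def bij_betw_def by (simp add: the_inv_into_f_f)

lemma lab_vtx: "labelled_graph G \<Longrightarrow> k \<in> labels G \<Longrightarrow> lab G (vtx G k) = k"
  unfolding vtx_def labelled_graph_def by (metis bij_betw_def f_the_inv_into_f)

lemma lab_in_labels: "labelled_graph G \<Longrightarrow> v \<in> verts G \<Longrightarrow> lab G v \<in> labels G"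
  unfolding labelled_graph_def by (metis bij_betwE)

lemma vtx_in_verts: "labelled_graph G \<Longrightarrow> k \<in> labels G \<Longrightarrow> vtx G k \<in> verts G"
  unfolding vtx_def labelled_graph_def by (metis bij_betw_def the_inv_into_into subset_refl)

lemma finite_labels: "labelled_graph G \<Longrightarrow> finite (labels G)"
  unfolding labelled_graph_def using bij_betw_finite by blast

lemma inj_on_vtx: "labelled_graph G \<Longrightarrow> inj_on (vtx G) (labels G)"
  by (metis inj_on_inverseI lab_vtx)

lemma edges_subset_verts: "labelled_graph G \<Longrightarrow> e \<in> edges G \<Longrightarrow> e \<subseteq> verts G"
  unfolding labelled_graph_def all_pairs_def by blast

lemma edge_pair:
  "labelled_graph G \<Longrightarrow> e \<in> edges G \<Longrightarrow> \<exists>u v. e = {u, v} \<and> u \<in> verts G \<and> v \<in> verts G \<and> u \<noteq> v"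
  unfolding labelled_graph_def all_pairs_def by blast

section \<open>Edges as sets of labels\<close>

lemma label_edges_eq:
  assumes G: "labelled_graph G"
  shows "label_edges G = (`) (lab G) ` edges G"
proof
  show "label_edges G \<subseteq> (`) (lab G) ` edges G"
  proof
    fix e assume "e \<in> label_edges G"
    then obtain k l where e: "e = {k, l}" "k \<in> labels G" "l \<in> labels G" "{vtx G k, vtx G l} \<in> edges G"
      unfolding label_edges_def by blast
    then have "e = lab G ` {vtx G k, vtx G l}"
      using lab_vtx[OF G] by simp
    with e show "e \<in> (`) (lab G) ` edges G" by blast
  qed
  show "(`) (lab G) ` edges G \<subseteq> label_edges G"
  proof clarify
    fix e assume e: "e \<in> edges G"
    then obtain v w where vw: "e = {v, w}" "v \<in> verts G" "w \<in> verts G"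
      using edge_pair[OF G] by blast
    then have "{vtx G (lab G v), vtx G (lab G w)} \<in> edges G"
      using e by (simp add: vtx_lab[OF G])
    with vw show "lab G ` e \<in> label_edges G"
      unfolding label_edges_def using lab_in_labels[OF G] by auto
  qed
qed

lemma label_edges_subset:
  assumes G: "labelled_graph G"
  shows "label_edges G \<subseteq> all_pairs (labels G)"
proof
  fix e assume "e \<in> label_edges G"
  then obtain k l where e: "e = {k, l}" "k \<in> labels G" "l \<in> labels G" "{vtx G k, vtx G l} \<in> edges G"
    unfolding label_edges_def by blast
  then have "vtx G k \<noteq> vtx G l"
    using edge_pair[OF G] by (metis doubleton_eq_iff)
  with e show "e \<in> all_pairs (labels G)"
    unfolding all_pairs_def by auto
qed

lemma label_edge_subset_labels: "labelled_graph G \<Longrightarrow> e \<in> label_edges G \<Longrightarrow> e \<subseteq> labels G"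
  using label_edges_subset unfolding all_pairs_def by blast

lemma finite_label_edges: "labelled_graph G \<Longrightarrow> finite (label_edges G)"
  by (meson PowI finite_Pow_iff finite_labels finite_subset label_edge_subset_labels subsetI)

lemma lab_vtx_image: "labelled_graph G \<Longrightarrow> e \<subseteq> labels G \<Longrightarrow> lab G ` vtx G ` e = e"
  by (force simp: lab_vtx image_image)

lemma vtx_lab_image: "labelled_graph G \<Longrightarrow> e \<subseteq> verts G \<Longrightarrow> vtx G ` lab G ` e = e"
  by (force simp: vtx_lab image_image)

lemma vtx_image_in_edges_iff:
  assumes "labelled_graph G" "e \<subseteq> labels G"
  shows "vtx G ` e \<in> edges G \<longleftrightarrow> e \<in> label_edges G"
  using assms edges_subset_verts lab_vtx_image vtx_lab_image
  by (metis (no_types, lifting) image_iff label_edges_eq)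

lemma edges_eq:
  assumes G: "labelled_graph G"
  shows "edges G = (`) (vtx G) ` label_edges G"
  using vtx_lab_image[OF G edges_subset_verts[OF G]]
  by (force simp: label_edges_eq[OF G] image_image)

text \<open>For a permutation \<open>\<sigma>\<close> of the labels, this is the set of label edges
  of \<open>perm_graph G \<sigma>\<close>. Ranging over all subsets of labels is harmless, because
  injectivity forces each member to be a pair.\<close>

definition preimage_edges :: "('v, 'x) lgraph \<Rightarrow> ('x \<Rightarrow> 'x) \<Rightarrow> 'x set set" where
  "preimage_edges G \<sigma> = {e. e \<subseteq> labels G \<and> \<sigma> ` e \<in> label_edges G}"

lemma edges_perm_graph:
  assumes G: "labelled_graph G" and \<sigma>: "\<sigma> permutes labels G"
  shows "edges (perm_graph G \<sigma>) = (`) (vtx G) ` preimage_edges G \<sigma>"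
proof
  show "edges (perm_graph G \<sigma>) \<subseteq> (`) (vtx G) ` preimage_edges G \<sigma>"
  proof
    fix f assume "f \<in> edges (perm_graph G \<sigma>)"
    then obtain k l where "f = vtx G ` {k, l}" "{k, l} \<subseteq> labels G" "\<sigma> ` {k, l} \<in> label_edges G"
      unfolding perm_graph_def by auto
    then show "f \<in> (`) (vtx G) ` preimage_edges G \<sigma>"
      unfolding preimage_edges_def by blast
  qed
  show "(`) (vtx G) ` preimage_edges G \<sigma> \<subseteq> edges (perm_graph G \<sigma>)"
  proof clarify
    fix e assume "e \<in> preimage_edges G \<sigma>"
    then have e: "e \<subseteq> labels G" "\<sigma> ` e \<in> label_edges G"
      unfolding preimage_edges_def by auto
    obtain k l where "\<sigma> ` e = {k, l}"
      using e(2) unfolding label_edges_def by blast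
    then have "e = {inv_into UNIV \<sigma> k, inv_into UNIV \<sigma> l}"
      by (metis \<sigma> image_empty image_insert image_inv_f_f permutes_inj)
    then obtain k l where "e = {k, l}" by blast
    with e show "vtx G ` e \<in> edges (perm_graph G \<sigma>)"
      unfolding perm_graph_def by auto
  qed
qed

text \<open>Both records differ from \<open>G\<close> in their edges at most, and
  \<open>vtx G\<close> is injective on subsets of the labels. Questions about permuted graphs thus
  become questions about families of label sets.\<close>

lemma perm_graph_eq_iff:
  assumes G: "labelled_graph G" and \<sigma>: "\<sigma> permutes labels G" and M: "M \<subseteq> Pow (labels G)"
  shows "perm_graph G \<sigma> = G\<lparr>edges := (`) (vtx G) ` M\<rparr> \<longleftrightarrow> preimage_edges G \<sigma> = M"
proof -
  have "perm_graph G \<sigma> = G\<lparr>edges := edges (perm_graph G \<sigma>)\<rparr>"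
    unfolding perm_graph_def by simp
  then have "perm_graph G \<sigma> = G\<lparr>edges := (`) (vtx G) ` M\<rparr> \<longleftrightarrow> edges (perm_graph G \<sigma>) = (`) (vtx G) ` M"
    by (metis lgraph.select_convs(2) lgraph.surjective lgraph.update_convs(2))
  also have "\<dots> \<longleftrightarrow> preimage_edges G \<sigma> = M"
    unfolding edges_perm_graph[OF G \<sigma>]
    by (rule inj_on_image_eq_iff[OF inj_on_image_Pow[OF inj_on_vtx[OF G]]])
      (use M in \<open>auto simp: preimage_edges_def\<close>)
  finally show ?thesis .
qed

lemma label_edges_Pow: "labelled_graph G \<Longrightarrow> label_edges G \<subseteq> Pow (labels G)"
  using label_edge_subset_labels by blast

lemma replace_edge_eq:
  assumes G: "labelled_graph G" and "e \<subseteq> labels G"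
  shows "replace_edge G e e' = G\<lparr>edges := (`) (vtx G) ` (insert e' (label_edges G - {e}))\<rparr>"
proof -
  have "edges G - {vtx G ` e} = (`) (vtx G) ` (label_edges G - {e})"
    using inj_on_image_set_diff[OF inj_on_image_Pow[OF inj_on_vtx[OF G]], of "label_edges G" "{e}"]
      assms label_edges_Pow[OF G] edges_eq[OF G] by auto
  then show ?thesis
    by (simp add: replace_edge_def)
qed

text \<open>Taking images under \<open>\<sigma>\<close> is a bijection between the two families.
  This count later upgrades inclusions of edge sets to equalities.\<close>

lemma card_preimage_edges:
  assumes G: "labelled_graph G" and \<sigma>: "\<sigma> permutes labels G"
  shows "card (preimage_edges G \<sigma>) = card (label_edges G)"
proof -
  have "(`) \<sigma> ` preimage_edges G \<sigma> = label_edges G"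
  proof
    show "label_edges G \<subseteq> (`) \<sigma> ` preimage_edges G \<sigma>"
    proof
      fix e assume e: "e \<in> label_edges G"
      then have "e \<subseteq> \<sigma> ` labels G"
        using label_edge_subset_labels[OF G] permutes_image[OF \<sigma>] by blast
      then obtain e' where "e' \<subseteq> labels G" "e = \<sigma> ` e'"
        by (auto simp: subset_image_iff)
      with e show "e \<in> (`) \<sigma> ` preimage_edges G \<sigma>"
        unfolding preimage_edges_def by blast
    qed
  qed (auto simp: preimage_edges_def)
  moreover have "inj_on ((`) \<sigma>) (preimage_edges G \<sigma>)"
    by (rule inj_onI) (simp add: inj_image_eq_iff[OF permutes_inj[OF \<sigma>]])
  ultimately show ?thesis
    by (metis card_image)
qed

lemma finite_preimage_edges: "labelled_graph G \<Longrightarrow> finite (preimage_edges G \<sigma>)"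
  by (rule finite_subset[of _ "Pow (labels G)"]) (auto simp: preimage_edges_def finite_labels)

text \<open>Mapping edges to edges puts \<open>label_edges G\<close> inside
  \<open>preimage_edges G \<sigma>\<close>; equal finite cardinalities make the two
  coincide.\<close>

lemma Aut_iff:
  assumes G: "labelled_graph G"
  shows "\<sigma> \<in> Aut G \<longleftrightarrow> \<sigma> permutes labels G \<and> (\<forall>f\<in>label_edges G. \<sigma> ` f \<in> label_edges G)"
proof (cases "\<sigma> permutes labels G")
  case \<sigma>: True
  have "perm_graph G \<sigma> = G \<longleftrightarrow> preimage_edges G \<sigma> = label_edges G"
    using perm_graph_eq_iff[OF G \<sigma> label_edges_Pow[OF G]] by (simp flip: edges_eq[OF G])
  also have "\<dots> \<longleftrightarrow> label_edges G \<subseteq> preimage_edges G \<sigma>"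
    using card_subset_eq[OF finite_preimage_edges[OF G], of "label_edges G" \<sigma>]
      card_preimage_edges[OF G \<sigma>] by auto
  also have "\<dots> \<longleftrightarrow> (\<forall>f\<in>label_edges G. \<sigma> ` f \<in> label_edges G)"
    using label_edge_subset_labels[OF G] by (auto simp: preimage_edges_def)
  finally show ?thesis
    using \<sigma> by (simp add: Aut_def)
qed (simp add: Aut_def)

text \<open>The isomorphism is \<open>\<sigma>\<close> transported to vertices. It yields
  feasibility of any replacement whose result is a permuted copy of \<open>G\<close>.\<close>

lemma graph_iso_perm_graph:
  assumes G: "labelled_graph G" and \<sigma>: "\<sigma> permutes labels G"
  shows "graph_iso (perm_graph G \<sigma>) G"
proof -
  let ?f = "vtx G \<circ> \<sigma> \<circ> lab G"
  have "bij_betw (vtx G) (labels G) (verts G)"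
    using G by (simp add: labelled_graph_def vtx_def[abs_def] bij_betw_the_inv_into)
  then have "bij_betw ?f (verts G) (verts G)"
    using G \<sigma> unfolding labelled_graph_def by (meson bij_betw_trans permutes_imp_bij)
  moreover have "{v, w} \<in> edges (perm_graph G \<sigma>) \<longleftrightarrow> {?f v, ?f w} \<in> edges G"
    if vw: "v \<in> verts G" "w \<in> verts G" for v w
  proof -
    let ?e = "{lab G v, lab G w}"
    have e: "?e \<subseteq> labels G" "\<sigma> ` ?e \<subseteq> labels G"
      using vw lab_in_labels[OF G] permutes_in_image[OF \<sigma>] by auto
    have "{v, w} \<in> edges (perm_graph G \<sigma>) \<longleftrightarrow> vtx G ` ?e \<in> (`) (vtx G) ` preimage_edges G \<sigma>"
      using vw by (simp add: vtx_lab[OF G] edges_perm_graph[OF G \<sigma>])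
    also have "\<dots> \<longleftrightarrow> ?e \<in> preimage_edges G \<sigma>"
      by (rule inj_on_image_mem_iff[OF inj_on_image_Pow[OF inj_on_vtx[OF G]]])
        (use e in \<open>auto simp: preimage_edges_def\<close>)
    also have "\<dots> \<longleftrightarrow> vtx G ` \<sigma> ` ?e \<in> edges G"
      using e vtx_image_in_edges_iff[OF G e(2)] by (simp add: preimage_edges_def)
    finally show ?thesis by simp
  qed
  ultimately show ?thesis
    unfolding graph_iso_def by (intro exI[of _ ?f]) (auto simp: perm_graph_def)
qed

text \<open>A permutation keeping all edges but \<open>e\<close> has a preimage family that contains
  \<open>label_edges G - {e}\<close> and has the size of \<open>label_edges G\<close>. If it is no
  automorphism, exactly one further pair \<open>e'\<close> is left over, and this is the added
  edge.\<close>

lemma Fer_all_iff: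
  assumes G: "labelled_graph G"
  shows "\<sigma> \<in> Fer_all G \<longleftrightarrow>
    \<sigma> permutes labels G \<and> (\<exists>e. \<forall>f\<in>label_edges G - {e}. \<sigma> ` f \<in> label_edges G)"
    (is "_ \<longleftrightarrow> ?rhs")
proof
  assume "\<sigma> \<in> Fer_all G"
  then consider "\<sigma> \<in> Aut G" | e e' where "feasible G e e'" "\<sigma> \<in> Fer G (Replace e e')"
    unfolding Fer_all_def feasible_replacements_def by force
  then show ?rhs
  proof cases
    case 1
    then show ?thesis using Aut_iff[OF G] by blast
  next
    case (2 e e')
    then have \<sigma>: "\<sigma> permutes labels G" and ee': "e \<subseteq> labels G" "e' \<subseteq> labels G"
      and eq: "perm_graph G \<sigma> = replace_edge G e e'"
      unfolding feasible_def edge_replacement_def by auto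
    have "preimage_edges G \<sigma> = insert e' (label_edges G - {e})"
      using perm_graph_eq_iff[OF G \<sigma>, of "insert e' (label_edges G - {e})"] eq
        replace_edge_eq[OF G ee'(1)] ee'(2) label_edges_Pow[OF G] by auto
    then have "\<forall>f\<in>label_edges G - {e}. \<sigma> ` f \<in> label_edges G"
      unfolding preimage_edges_def by blast
    with \<sigma> show ?thesis by blast
  qed
next
  assume ?rhs
  then obtain e where \<sigma>: "\<sigma> permutes labels G"
    and e: "\<forall>f\<in>label_edges G - {e}. \<sigma> ` f \<in> label_edges G" by blast
  show "\<sigma> \<in> Fer_all G"
  proof (cases "\<sigma> \<in> Aut G")
    case True
    then show ?thesis
      unfolding Fer_all_def feasible_replacements_def by (auto intro!: bexI[of _ Neutral])
  next
    case False
    \<comment> \<open>A non-automorphism sends some edge to a non-edge, and by assumption only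
      \<open>e\<close> can be that edge.\<close>
    then have eL: "e \<in> label_edges G" "\<sigma> ` e \<notin> label_edges G"
      using e \<sigma> Aut_iff[OF G] by blast+
    let ?M = "preimage_edges G \<sigma>"
    have sub: "label_edges G - {e} \<subseteq> ?M"
      using e label_edge_subset_labels[OF G] by (auto simp: preimage_edges_def)
    have "card (?M - (label_edges G - {e})) = 1"
    proof -
      have "card (label_edges G) > 0"
        using eL finite_label_edges[OF G] by (auto simp: card_gt_0_iff)
      then show ?thesis
        using card_Diff_subset[OF _ sub] eL(1) finite_label_edges[OF G] card_preimage_edges[OF G \<sigma>]
        by simp
    qed
    then obtain e' where e': "?M - (label_edges G - {e}) = {e'}"
      by (metis card_1_singletonE)
    then have M: "?M = insert e' (label_edges G - {e})"
      using sub by blast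
    have "e \<notin> ?M"
      using eL by (simp add: preimage_edges_def)
    \<comment> \<open>The new member \<open>e'\<close> lies outside
      \<open>label_edges G - {e}\<close>, and it is not \<open>e\<close>, which is no member of the
      preimage family. So it is a non-edge of \<open>G\<close>.\<close>
    then have "e' \<noteq> e" and e'L: "e' \<notin> label_edges G"
      using e' by auto
    have ee': "e \<subseteq> labels G" "e' \<subseteq> labels G"
      using label_edge_subset_labels[OF G eL(1)] M by (auto simp: preimage_edges_def)
    have eq: "perm_graph G \<sigma> = replace_edge G e e'"
      using perm_graph_eq_iff[OF G \<sigma>, of ?M] replace_edge_eq[OF G ee'(1)] M
      by (auto simp: preimage_edges_def)
    have "vtx G ` e' \<in> complement_edges G"
    proof -
      \<comment> \<open>So far \<open>e'\<close> is only a set of labels; it has two elements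
        because its image under the injective \<open>\<sigma>\<close> is an edge.\<close>
      have "card e' = 2"
      proof -
        have "\<sigma> ` e' \<in> all_pairs (labels G)"
          using M label_edges_subset[OF G] by (auto simp: preimage_edges_def)
        then have "card (\<sigma> ` e') = 2"
          by (auto simp: all_pairs_def)
        then show ?thesis
          by (metis \<sigma> card_image inj_on_subset permutes_inj subset_UNIV)
      qed
      then obtain k l where kl: "e' = {k, l}" "k \<noteq> l"
        by (auto simp: card_2_iff)
      then have "vtx G k \<noteq> vtx G l"
        using ee'(2) inj_on_vtx[OF G] by (auto dest: inj_onD)
      then have "vtx G ` e' \<in> all_pairs (verts G)"
        using kl ee'(2) vtx_in_verts[OF G] unfolding all_pairs_def by auto
      then show ?thesis
        using e'L vtx_image_in_edges_iff[OF G ee'(2)] by (simp add: complement_edges_def)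
    qed
    then have "feasible G e e'"
      using ee' eL(1) vtx_image_in_edges_iff[OF G] graph_iso_perm_graph[OF G \<sigma>] eq
      by (simp add: feasible_def edge_replacement_def)
    then have "Replace e e' \<in> feasible_replacements G"
      using \<open>e' \<noteq> e\<close> by (auto simp: feasible_replacements_def)
    moreover have "\<sigma> \<in> Fer G (Replace e e')"
      using \<sigma> eq by simp
    ultimately show ?thesis
      unfolding Fer_all_def by blast
  qed
qed

lemma Fer_fix_Un_Aut_subset: "labelled_graph G \<Longrightarrow> Fer_fix G i \<union> Aut G \<subseteq> carrier (Sym (labels G))"
  by (auto simp: Fer_fix_def Fer_all_iff Aut_def)

lemma subgroup_hang_group:
  "labelled_graph G \<Longrightarrow> subgroup (hang_group G i) (Sym (labels G))"
  unfolding hang_group_def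
  by (intro group.generate_is_subgroup group_Sym Fer_fix_Un_Aut_subset)

section \<open>Leaves\<close>

text \<open>Degree one phrased on labels as unique existence, which gives direct access to the one
  incident edge.\<close>

definition leaf_label :: "('v, 'x) lgraph \<Rightarrow> 'x \<Rightarrow> bool" where
  "leaf_label G y \<longleftrightarrow> (\<exists>!e. e \<in> label_edges G \<and> y \<in> e)"

lemma leaf_imp_leaf_label:
  assumes G: "labelled_graph G" and "leaf G v"
  shows "leaf_label G (lab G v)"
proof -
  have v: "v \<in> verts G"
    using assms(2) by (simp add: leaf_def)
  obtain e where e: "{e \<in> edges G. v \<in> e} = {e}"
    using assms(2) unfolding leaf_def degree_def by (metis card_1_singletonE)
  have "f = lab G ` e" if f: "f \<in> label_edges G" "lab G v \<in> f" for f
  proof -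
    obtain f' where f': "f' \<in> edges G" "f = lab G ` f'"
      using f(1) label_edges_eq[OF G] by blast
    then have "v \<in> f'"
      by (metis G edges_subset_verts f(2) image_eqI v vtx_lab vtx_lab_image)
    with e f' show ?thesis by blast
  qed
  moreover have "lab G ` e \<in> label_edges G" "lab G v \<in> lab G ` e"
    using e label_edges_eq[OF G] by blast+
  ultimately show ?thesis
    unfolding leaf_label_def by blast
qed

text \<open>An automorphism permutes the edges, so those at \<open>\<sigma> y\<close> are exactly
  the images of those at \<open>y\<close>.\<close>

lemma leaf_label_Aut:
  assumes G: "labelled_graph G" and \<sigma>: "\<sigma> \<in> Aut G" and y: "leaf_label G y"
  shows "leaf_label G (\<sigma> y)"
proof -
  obtain e where e: "e \<in> label_edges G" "y \<in> e"
    and e_unique: "\<And>f. f \<in> label_edges G \<Longrightarrow> y \<in> f \<Longrightarrow> f = e"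
    using y unfolding leaf_label_def by metis
  have p: "\<sigma> permutes labels G" and pres: "\<forall>f\<in>label_edges G. \<sigma> ` f \<in> label_edges G"
    using \<sigma> Aut_iff[OF G] by auto
  have inj: "inj ((`) \<sigma>)"
    by (rule injI) (simp add: inj_image_eq_iff[OF permutes_inj[OF p]])
  \<comment> \<open>Edges are sent injectively into the finite set of edges, hence onto it.\<close>
  have surj: "(`) \<sigma> ` label_edges G = label_edges G"
    by (rule card_subset_eq[OF finite_label_edges[OF G]])
      (use pres in blast, rule card_image[OF inj_on_subset[OF inj subset_UNIV]])
  have "f = \<sigma> ` e" if f: "f \<in> label_edges G" "\<sigma> y \<in> f" for f
  proof -
    have "f \<in> (`) \<sigma> ` label_edges G"
      using surj f(1) by simp
    then obtain f' where f': "f' \<in> label_edges G" "f = \<sigma> ` f'"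
      by (elim imageE)
    then have "y \<in> f'"
      using f(2) permutes_inj[OF p] by (simp add: inj_image_mem_iff)
    with f' e_unique show ?thesis by blast
  qed
  then show ?thesis
    unfolding leaf_label_def using e pres by blast
qed

lemma subgroup_stabiliser: "subgroup {\<sigma>. \<sigma> permutes X \<and> \<sigma> i = i} (Sym X)"
  by (rule group.subgroupI[OF group_Sym])
    (auto simp: m_inv_Sym permutes_inv permutes_compose permutes_inv_eq intro: permutes_id)

text \<open>The full symmetric group moves \<open>i\<close>, so some automorphism does; applied to the leaf \<open>i\<close>,
  it yields another leaf.\<close>

lemma hang_symmetric_leaf_neq:
  assumes G: "labelled_graph G" and leaf: "leaf_label G y" and "i \<in> labels G"
    and hang: "hang_group G i = carrier (Sym (labels G))"
  shows "\<exists>z \<in> labels G - {i}. leaf_label G z"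
proof -
  obtain e where e: "e \<in> label_edges G" "y \<in> e"
    using leaf unfolding leaf_label_def by blast
  then have y: "y \<in> labels G"
    using label_edge_subset_labels[OF G] by blast
  show ?thesis
  proof (cases "y = i")
    case True
    \<comment> \<open>The edge at the leaf has two ends, so some label differs from \<open>i\<close>
      and the symmetric group does move \<open>i\<close>.\<close>
    obtain z where z: "z \<in> labels G" "z \<noteq> i"
      using label_edges_subset[OF G] e unfolding all_pairs_def by blast
    have "\<exists>\<sigma>\<in>Aut G. \<sigma> i \<noteq> i"
    proof (rule ccontr)
      assume "\<not> ?thesis"
      \<comment> \<open>Members of \<open>Fer_fix G i\<close> fix \<open>i\<close> by definition. If
        all automorphisms did too, every generator would lie in the stabiliser of
        \<open>i\<close>.\<close>
      then have "Fer_fix G i \<union> Aut G \<subseteq> {\<sigma>. \<sigma> permutes labels G \<and> \<sigma> i = i}"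
        using Fer_fix_Un_Aut_subset[OF G, of i] by (auto simp: Fer_fix_def)
      then have "hang_group G i \<subseteq> {\<sigma>. \<sigma> permutes labels G \<and> \<sigma> i = i}"
        unfolding hang_group_def
        by (rule group.generate_subgroup_incl[OF group_Sym _ subgroup_stabiliser])
      moreover have "transpose i z \<in> hang_group G i"
        using permutes_swap_id[OF \<open>i \<in> labels G\<close> z(1)] by (simp add: hang)
      ultimately show False
        using z(2) by auto
    qed
    then obtain \<sigma> where "\<sigma> \<in> Aut G" "\<sigma> i \<noteq> i" by blast
    then show ?thesis
      using leaf_label_Aut[OF G _ leaf] True \<open>i \<in> labels G\<close> permutes_in_image
      by (metis Aut_iff[OF G] Diff_iff singletonD)
  qed (use leaf y in auto)
qed

section \<open>Comb products\<close>

lemma labelled_graph_comb_product: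
  assumes G: "labelled_graph G" and H: "labelled_graph H" and r: "r \<in> verts H"
  shows "labelled_graph (comb_product G H r)"
  unfolding labelled_graph_def
proof (intro conjI)
  show "finite (verts (comb_product G H r))"
    using G H by (simp add: comb_product_def labelled_graph_def)
  show "edges (comb_product G H r) \<subseteq> all_pairs (verts (comb_product G H r))"
  proof -
    have "u \<in> verts G \<and> u' \<in> verts G \<and> u \<noteq> u'" if "{u, u'} \<in> edges G" for u u'
      using edge_pair[OF G that] by (auto simp: doubleton_eq_iff)
    moreover have "w \<in> verts H \<and> w' \<in> verts H \<and> w \<noteq> w'" if "{w, w'} \<in> edges H" for w w'
      using edge_pair[OF H that] by (auto simp: doubleton_eq_iff)
    ultimately show ?thesis
      using r unfolding comb_product_def all_pairs_def by fastforce
  qed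
  have "bij_betw (prod.swap \<circ> map_prod (lab G) (lab H)) (verts G \<times> verts H) (labels H \<times> labels G)"
  proof (rule bij_betw_trans)
    show "bij_betw (map_prod (lab G) (lab H)) (verts G \<times> verts H) (labels G \<times> labels H)"
      using G H by (simp add: labelled_graph_def bij_betw_map_prod)
    show "bij_betw prod.swap (labels G \<times> labels H) (labels H \<times> labels G)"
      by (auto simp: bij_betw_def)
  qed
  also have "prod.swap \<circ> map_prod (lab G) (lab H) = (\<lambda>(u, w). (lab H w, lab G u))"
    by auto
  finally show "bij_betw (lab (comb_product G H r)) (verts (comb_product G H r)) (labels (comb_product G H r))"
    by (simp add: comb_product_def)
qed

text \<open>Writing both kinds of edges as images, the copy of \<open>G\<close> at the root and the
  copies of \<open>H\<close>, lets the wreath generators act on them by composing images.\<close>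

lemma label_edges_comb_product:
  assumes G: "labelled_graph G" and H: "labelled_graph H" and r: "r \<in> verts H"
  shows "label_edges (comb_product G H r) =
    (`) (Pair (lab H r)) ` label_edges G \<union>
    (\<Union>x\<in>labels G. (`) (\<lambda>b. (b, x)) ` label_edges H)"
proof -
  have 1: "{{(u, r), (u', r)} | u u'. {u, u'} \<in> edges G} = (`) (\<lambda>u. (u, r)) ` edges G"
  proof
    show "(`) (\<lambda>u. (u, r)) ` edges G \<subseteq> {{(u, r), (u', r)} | u u'. {u, u'} \<in> edges G}"
    proof clarify
      fix e assume e: "e \<in> edges G"
      then obtain u u' where "e = {u, u'}" using edge_pair[OF G] by blast
      with e show "\<exists>u u'. (\<lambda>u. (u, r)) ` e = {(u, r), (u', r)} \<and> {u, u'} \<in> edges G" by blast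
    qed
  qed (auto intro: rev_image_eqI)
  have 2: "{{(u, w), (u, w')} | u w w'. u \<in> verts G \<and> {w, w'} \<in> edges H} =
      (\<Union>u\<in>verts G. (`) (Pair u) ` edges H)"
  proof
    show "(\<Union>u\<in>verts G. (`) (Pair u) ` edges H) \<subseteq>
        {{(u, w), (u, w')} | u w w'. u \<in> verts G \<and> {w, w'} \<in> edges H}"
    proof clarify
      fix u e assume u: "u \<in> verts G" and e: "e \<in> edges H"
      then obtain w w' where "e = {w, w'}" using edge_pair[OF H] by blast
      with u e show "\<exists>u' w w'. Pair u ` e = {(u', w), (u', w')} \<and> u' \<in> verts G \<and> {w, w'} \<in> edges H"
        by blast
    qed
  qed (auto intro: rev_image_eqI)
  have labels: "labels G = lab G ` verts G"
    using G by (simp add: labelled_graph_def bij_betw_def)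
  show ?thesis
    unfolding label_edges_eq[OF labelled_graph_comb_product[OF assms]]
      label_edges_eq[OF G] label_edges_eq[OF H] labels
    unfolding comb_product_def by (simp add: 1 2 image_Un image_UN image_image)
qed

section \<open>Action of the wreath generators on edges of the comb product\<close>

lemma wreath_base_image_Pair: "j \<in> B \<Longrightarrow> wreath_base B \<tau> ` Pair j ` e = Pair j ` \<tau> ` e"
  by (simp add: image_image wreath_base_apply)

lemma wreath_base_image_fibre:
  "e \<subseteq> B \<Longrightarrow> wreath_base B \<tau> ` (\<lambda>b. (b, x)) ` e = (\<lambda>b. (b, \<tau> x)) ` e"
  by (force simp: image_image wreath_base_apply)

text \<open>The two alternatives are the two ways a base edge survives: the root stays in place, or
  the edge avoids the altered copy.\<close>

lemma wreath_fibre_image_Pair: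
  "\<sigma> j = j \<or> y \<notin> e \<Longrightarrow> wreath_fibre y \<sigma> ` Pair j ` e = Pair j ` e"
  by (force simp: image_image wreath_fibre_apply)

lemma wreath_fibre_image_fibre:
  "wreath_fibre y \<sigma> ` (\<lambda>b. (b, x)) ` e = (\<lambda>b. (b, x)) ` (if x = y then \<sigma> ` e else e)"
  by (auto simp: image_image wreath_fibre_apply)

section \<open>Lifting the generators of both hang groups\<close>

locale rooted_comb =
  fixes G :: "('u, 'x) lgraph" and H :: "('w, 'b) lgraph" and r :: 'w
  assumes G: "labelled_graph G" and H: "labelled_graph H" and r: "r \<in> verts H"
begin

abbreviation "C \<equiv> comb_product G H r"

abbreviation "root_label \<equiv> lab H r"

lemma labels_C: "labels C = labels H \<times> labels G"
  by (simp add: comb_product_def)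

lemmas C = labelled_graph_comb_product[OF G H r]

lemmas label_edges_C = label_edges_comb_product[OF G H r]

lemma base_edge_in_C: "e \<in> label_edges G \<Longrightarrow> Pair root_label ` e \<in> label_edges C"
  by (simp add: label_edges_C)

lemma fibre_edge_in_C:
  "x \<in> labels G \<Longrightarrow> e \<in> label_edges H \<Longrightarrow> (\<lambda>b. (b, x)) ` e \<in> label_edges C"
  by (auto simp: label_edges_C)

lemma label_edge_C_cases:
  assumes "f \<in> label_edges C"
  obtains (base) e where "e \<in> label_edges G" "f = Pair root_label ` e"
    | (fibre) x e where "x \<in> labels G" "e \<in> label_edges H" "f = (\<lambda>b. (b, x)) ` e"
  using assms by (auto simp: label_edges_C)

lemma root_label_in_labels: "root_label \<in> labels H"
  using lab_in_labels[OF H r] .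

lemma wreath_base_fibre_edge:
  assumes "\<tau> permutes labels G" "x \<in> labels G" "e \<in> label_edges H"
  shows "wreath_base (labels H) \<tau> ` (\<lambda>b. (b, x)) ` e \<in> label_edges C"
  using assms permutes_in_image[OF assms(1)]
  by (simp add: wreath_base_image_fibre label_edge_subset_labels[OF H] fibre_edge_in_C)

lemma wreath_base_Aut:
  assumes "\<tau> \<in> Aut G"
  shows "wreath_base (labels H) \<tau> \<in> Aut C"
  using assms wreath_base_fibre_edge root_label_in_labels
  unfolding Aut_iff[OF C] Aut_iff[OF G] labels_C
  by (auto simp: base_edge_in_C wreath_base_image_Pair wreath_base_permutes elim!: label_edge_C_cases)

text \<open>The copies of \<open>H\<close> are permuted as wholes, so the only edge that may be lost
  is the root copy of the one lost by \<open>\<tau>\<close>.\<close>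

lemma wreath_base_Fer_fix:
  assumes "\<tau> \<in> Fer_fix G i"
  shows "wreath_base (labels H) \<tau> \<in> Fer_fix C (root_label, i)"
proof -
  obtain e where \<tau>: "\<tau> permutes labels G" "\<tau> i = i"
    and e: "\<forall>f\<in>label_edges G - {e}. \<tau> ` f \<in> label_edges G"
    using assms Fer_all_iff[OF G] by (auto simp: Fer_fix_def)
  have "wreath_base (labels H) \<tau> ` f \<in> label_edges C" if f: "f \<in> label_edges C - {Pair root_label ` e}" for f
  proof -
    from f have "f \<in> label_edges C" by simp
    then show ?thesis
    proof (cases rule: label_edge_C_cases)
      case (base g)
      with f e show ?thesis by (auto simp: wreath_base_image_Pair root_label_in_labels intro: base_edge_in_C)
    next
      case fibre
      with wreath_base_fibre_edge[OF \<tau>(1)] show ?thesis by simp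
    qed
  qed
  then show ?thesis
    using \<tau> by (auto simp: Fer_fix_def Fer_all_iff[OF C] labels_C wreath_base_permutes wreath_base_apply)
qed

text \<open>With the root fixed, base edges stay in place and only the copy of \<open>H\<close> at
  \<open>y\<close> changes, losing at most one edge. The label \<open>(root_label, i)\<close> is
  fixed even when \<open>y = i\<close>.\<close>

lemma wreath_fibre_Fer_fix:
  assumes "y \<in> labels G" "\<sigma> \<in> Fer_fix H root_label"
  shows "wreath_fibre y \<sigma> \<in> Fer_fix C (root_label, i)"
proof -
  obtain e where \<sigma>: "\<sigma> permutes labels H" "\<sigma> root_label = root_label"
    and e: "\<forall>f\<in>label_edges H - {e}. \<sigma> ` f \<in> label_edges H"
    using assms Fer_all_iff[OF H] by (auto simp: Fer_fix_def)
  have "wreath_fibre y \<sigma> ` f \<in> label_edges C" if f: "f \<in> label_edges C - {(\<lambda>b. (b, y)) ` e}" for f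
  proof -
    from f have "f \<in> label_edges C" by simp
    then show ?thesis
    proof (cases rule: label_edge_C_cases)
      case base
      with \<sigma>(2) show ?thesis by (simp add: wreath_fibre_image_Pair base_edge_in_C)
    next
      case (fibre x g)
      with f e show ?thesis by (auto simp: wreath_fibre_image_fibre intro!: fibre_edge_in_C)
    qed
  qed
  then show ?thesis
    using \<sigma> assms(1)
    by (auto simp: Fer_fix_def Fer_all_iff[OF C] labels_C wreath_fibre_permutes wreath_fibre_apply)
qed

text \<open>Moving the root of the copy of \<open>H\<close> at a leaf only changes the edge at that leaf.\<close>

lemma wreath_fibre_leaf_Aut:
  assumes "y \<in> labels G" "leaf_label G y" "y \<noteq> i" "\<sigma> \<in> Aut H"
  shows "wreath_fibre y \<sigma> \<in> Fer_fix C (root_label, i)"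
proof -
  obtain e where e: "\<And>f. f \<in> label_edges G \<Longrightarrow> y \<in> f \<Longrightarrow> f = e"
    using assms(2) unfolding leaf_label_def by metis
  have \<sigma>: "\<sigma> permutes labels H" "\<forall>f\<in>label_edges H. \<sigma> ` f \<in> label_edges H"
    using assms(4) Aut_iff[OF H] by auto
  have "wreath_fibre y \<sigma> ` f \<in> label_edges C" if f: "f \<in> label_edges C - {Pair root_label ` e}" for f
  proof -
    from f have "f \<in> label_edges C" by simp
    then show ?thesis
    proof (cases rule: label_edge_C_cases)
      case (base g)
      \<comment> \<open>The only edge at the leaf is \<open>e\<close>, and its root copy is the
        exempted edge.\<close>
      then have "y \<notin> g" using e f by blast
      with base show ?thesis by (simp add: wreath_fibre_image_Pair base_edge_in_C)
    next
      case (fibre x g)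
      with \<sigma>(2) show ?thesis by (simp add: wreath_fibre_image_fibre fibre_edge_in_C)
    qed
  qed
  \<comment> \<open>Although \<open>\<sigma>\<close> may move the root,
    \<open>(root_label, i)\<close> stays fixed because it lies in a copy other than that at
    \<open>y\<close>.\<close>
  then show ?thesis
    using \<sigma> assms(1,3)
    by (auto simp: Fer_fix_def Fer_all_iff[OF C] labels_C wreath_fibre_permutes wreath_fibre_apply)
qed

text \<open>Hang-symmetry of \<open>G\<close> yields all base lifts and that of \<open>H\<close> all
  fibre lifts at one leaf; conjugation by base lifts spreads the latter to every copy.\<close>

lemma full_wreath_subset_hang_group:
  assumes "leaf G v" "i \<in> labels G"
    and hang_G: "hang_group G i = carrier (Sym (labels G))"
    and hang_H: "hang_group H root_label = carrier (Sym (labels H))"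
  shows "full_wreath (labels H) (labels G) \<subseteq> hang_group C (root_label, i)"
proof -
  let ?K = "hang_group C (root_label, i)"
  have K: "subgroup ?K (Sym (labels H \<times> labels G))"
    using subgroup_hang_group[OF C] by (simp add: labels_C)
  have incl: "Fer_fix C (root_label, i) \<union> Aut C \<subseteq> ?K"
    unfolding hang_group_def by (blast intro: generate.incl)
  have base: "wreath_base (labels H) \<tau> \<in> ?K" if "\<tau> permutes labels G" for \<tau>
  proof -
    have "wreath_base (labels H) ` hang_group G i =
        generate (Sym (labels H \<times> labels G)) (wreath_base (labels H) ` (Fer_fix G i \<union> Aut G))"
      unfolding hang_group_def
      by (rule group_hom.generate_img[OF group_hom_wreath_base Fer_fix_Un_Aut_subset[OF G], symmetric])
    also have "\<dots> \<subseteq> ?K"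
      by (rule group.generate_subgroup_incl[OF group_Sym _ K])
        (use incl wreath_base_Fer_fix wreath_base_Aut in blast)
    finally show ?thesis
      using that hang_G by auto
  qed
  obtain y where y: "y \<in> labels G" "y \<noteq> i" "leaf_label G y"
    using hang_symmetric_leaf_neq[OF G leaf_imp_leaf_label[OF G assms(1)] assms(2) hang_G] by blast
  have fibre_y: "wreath_fibre y \<sigma> \<in> ?K" if "\<sigma> permutes labels H" for \<sigma>
  proof -
    have "wreath_fibre y ` hang_group H root_label =
        generate (Sym (labels H \<times> labels G)) (wreath_fibre y ` (Fer_fix H root_label \<union> Aut H))"
      unfolding hang_group_def
      by (rule group_hom.generate_img[OF group_hom_wreath_fibre[OF y(1)] Fer_fix_Un_Aut_subset[OF H], symmetric])
    also have "\<dots> \<subseteq> ?K"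
      \<comment> \<open>Generators from \<open>Fer_fix H root_label\<close> fix the root and lift to
        any copy; automorphisms may move it and require the leaf \<open>y\<close>, chosen different
        from \<open>i\<close>.\<close>
      by (rule group.generate_subgroup_incl[OF group_Sym _ K])
        (use incl y wreath_fibre_Fer_fix wreath_fibre_leaf_Aut in blast)
    finally show ?thesis
      using that hang_H by auto
  qed
  have "wreath_fibre x \<sigma> \<in> ?K" if x: "x \<in> labels G" and \<sigma>: "\<sigma> permutes labels H" for x \<sigma>
  proof -
    let ?t = "wreath_base (labels H) (transpose x y)"
    \<comment> \<open>The involution \<open>?t\<close> swaps the copies at \<open>x\<close> and
      \<open>y\<close>, so conjugating by it moves the action of \<open>\<sigma>\<close> from
      \<open>y\<close> to \<open>x\<close>. Outside \<open>labels H\<close> both sides are the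
      identity.\<close>
    have "wreath_fibre x \<sigma> = ?t \<circ> wreath_fibre y \<sigma> \<circ> ?t"
      using permutes_in_image[OF \<sigma>] permutes_not_in[OF \<sigma>]
      by (auto simp: fun_eq_iff wreath_base_apply wreath_fibre_apply transpose_eq_iff)
    then show ?thesis
      using subgroup_Sym_comp[OF K] fibre_y[OF \<sigma>] base[OF permutes_swap_id[OF x y(1)]] by metis
  qed
  with base show ?thesis
    by (intro full_wreath_subset K)
qed

end

theorem corollary9:
  fixes G :: "('u, 'x) lgraph" and H :: "('w, 'b) lgraph"
    and u :: 'u and r :: 'w and i :: 'x and j :: 'b
  assumes "labelled_graph G" and "labelled_graph H"
    and "\<exists>v. leaf G v"
    and "u \<in> verts G" and "lab G u = i" and "hang_symmetric_at G u"
    and "r \<in> verts H" and "lab H r = j" and "hang_symmetric_at H r"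
  shows "hang_group (comb_product G H r) (j, i) =
           wreath (labels H) (labels G) (carrier (Sym (labels H))) (carrier (Sym (labels G)))
       \<or> hang_group (comb_product G H r) (j, i) = carrier (Sym (labels H \<times> labels G))"
proof -
  interpret rooted_comb G H r
    using assms by unfold_locales
  have j: "j = root_label"
    using assms(8) by simp
  obtain v where v: "leaf G v"
    using assms(3) by blast
  have i: "i \<in> labels G"
    using lab_in_labels[OF G assms(4)] assms(5) by simp
  have "hang_group G i = carrier (Sym (labels G))" "hang_group H j = carrier (Sym (labels H))"
    using assms by (simp_all add: hang_symmetric_at_def)
  then have "full_wreath (labels H) (labels G) \<subseteq> hang_group C (j, i)"
    unfolding j by (intro full_wreath_subset_hang_group[OF v i])
  moreover have "subgroup (hang_group C (j, i)) (Sym (labels H \<times> labels G))"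
    using subgroup_hang_group[OF C] by (simp add: labels_C)
  moreover have "labels H \<noteq> {}"
    using root_label_in_labels by blast
  ultimately show ?thesis
    by (intro full_wreath_maximal finite_labels G H)
qed

end
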